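(* Let $G$ be a finitely generated group whose number of ends satisfies $e(G)\geq 2$. Then there exist $G$-effectively closed subshifts (over some finite alphabet) which are not sofic.
   Context: Let $G$ be a finitely generated group and $S\subset G$ a finite generating set closed under inverses and containing $1_G$. Words in $S^*$ represent elements of $G$; write $u=_G v$ if they represent the same element. $\mathtt{WP}(G)=\{w\in S^*: w=_G 1_G\}$ is the word problem. $\Gamma(G,S)$ is the undirected right Cayley graph (edges $\{g,gs\}$, $s\in S$), $B_n$ is its ball of radius $n$ about $1_G$, and the number of ends $e(G)$ is the limit as $n\to\infty$ of the number of infinite connected components of $\Gamma(G,S)\setminus B_n$ (it does not depend on $S$). For a finite alphabet $A$, $A^G$ has the product topology and the left shift action $(\sigma_g x)_h=x_{g^{-1}h}$. A subshift is a closed shift-invariant subset of some $A^G$. Put $[a]_g=\{x\in A^G: x_g=a\}$. A subshift $X \subset A^G$ is of finite type (SFT) if there is a finite set $\mathcal F$ of patterns (elements $p\in A^F$ with $F\subset G$ finite) such that $X=\bigcap_{p\in\mathcal F,\,g\in G}\big(A^G\setminus\bigcap_{h\in F_p}[p_h]_{gh}\big)$, where $F_p$ is the support of $p$. A subshift $Y$ is sofic if there is an SFT $Z$ on $G$ and a continuous shift-commuting surjection $Z\to Y$. A pattern coding over $A$ is a finite set $c$ of pairs $(w,a)$ with $w\in S^*$, $a\in A$. For a set $\mathcal C$ of pattern codings, $X_{\mathcal C}=\bigcap_{g\in G,\,c\in\mathcal C}\big(A^G\setminus\bigcap_{(w,a)\in c}[a]_{gw}\big)$. A subshift $X\subset A^G$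 is $G$-effectively closed if $X=X_{\mathcal C}$ for some set of pattern codings $\mathcal C$ that is recursively enumerable by a Turing machine with oracle $\mathtt{WP}(G)$. *)

theory Defs
  imports "HOL-Analysis.Analysis" "HOL-Algebra.Generated_Groups"
begin

definition word_val :: "('a, 'm) monoid_scheme \<Rightarrow> 'a list \<Rightarrow> 'a" where
  "word_val G w = foldr (\<lambda>s g. s \<otimes>\<^bsub>G\<^esub> g) w \<one>\<^bsub>G\<^esub>"

definition word_problem :: "('a, 'm) monoid_scheme \<Rightarrow> 'a set \<Rightarrow> 'a list set" where
  "word_problem G S = {w \<in> lists S. word_val G w = \<one>\<^bsub>G\<^esub>}"

definition cayley_edges :: "('a, 'm) monoid_scheme \<Rightarrow> 'a set \<Rightarrow> 'a set set" where
  "cayley_edges G S = {{g, g \<otimes>\<^bsub>G\<^esub> s} | g s. g \<in> carrier G \<and> s \<in> S}"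

definition cayley_adj :: "('a, 'm) monoid_scheme \<Rightarrow> 'a set \<Rightarrow> ('a \<times> 'a) set" where
  "cayley_adj G S = {(g, h). {g, h} \<in> cayley_edges G S}"

definition cayley_ball :: "('a, 'm) monoid_scheme \<Rightarrow> 'a set \<Rightarrow> nat \<Rightarrow> 'a set" where
  "cayley_ball G S n = {g. \<exists>k\<le>n. (\<one>\<^bsub>G\<^esub>, g) \<in> cayley_adj G S ^^ k}"

text \<open>Vertex sets of the connected components of the subgraph induced on \<open>V\<close>.\<close>

definition cayley_components :: "('a, 'm) monoid_scheme \<Rightarrow> 'a set \<Rightarrow> 'a set \<Rightarrow> 'a set set" where
  "cayley_components G S V = V // ((cayley_adj G S \<inter> V \<times> V)\<^sup>*)"

text \<open>
  For finite \<open>S\<close> the graph is locally finite, so removing a ball leaves finitely many components and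
  \<open>card\<close> is the true number of infinite ones. The limit is taken in \<open>enat\<close>, since the sequence
  is unbounded when there are infinitely many ends.
\<close>

definition number_of_ends :: "('a, 'm) monoid_scheme \<Rightarrow> 'a set \<Rightarrow> enat" where
  "number_of_ends G S =
     lim (\<lambda>n. enat (card {C \<in> cayley_components G S (carrier G - cayley_ball G S n). infinite C}))"

text \<open>
  Configurations are extensional functions on the carrier: the underlying set of
  \<open>full_shift_topology G A\<close> is \<open>full_shift G A\<close>.
\<close>

definition full_shift :: "('a, 'm) monoid_scheme \<Rightarrow> 'l set \<Rightarrow> ('a \<Rightarrow> 'l) set" where
  "full_shift G A = (carrier G \<rightarrow>\<^sub>E A)"

definition full_shift_topology :: "('a, 'm) monoid_scheme \<Rightarrow> 'l set \<Rightarrow> ('a \<Rightarrow> 'l) topology" where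
  "full_shift_topology G A = product_topology (\<lambda>_. discrete_topology A) (carrier G)"

definition shift_action :: "('a, 'm) monoid_scheme \<Rightarrow> 'a \<Rightarrow> ('a \<Rightarrow> 'l) \<Rightarrow> 'a \<Rightarrow> 'l" where
  "shift_action G g x = (\<lambda>h\<in>carrier G. x (inv\<^bsub>G\<^esub> g \<otimes>\<^bsub>G\<^esub> h))"

definition subshift :: "('a, 'm) monoid_scheme \<Rightarrow> 'l set \<Rightarrow> ('a \<Rightarrow> 'l) set \<Rightarrow> bool" where
  "subshift G A X \<longleftrightarrow> finite A \<and> closedin (full_shift_topology G A) X \<and>
     (\<forall>g\<in>carrier G. \<forall>x\<in>X. shift_action G g x \<in> X)"

definition cylinder :: "('a, 'm) monoid_scheme \<Rightarrow> 'l set \<Rightarrow> 'l \<Rightarrow> 'a \<Rightarrow> ('a \<Rightarrow> 'l) set" where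
  "cylinder G A a g = {x \<in> full_shift G A. x g = a}"

text \<open>A pattern is a partial map whose domain is the support.\<close>

definition pattern :: "('a, 'm) monoid_scheme \<Rightarrow> 'l set \<Rightarrow> ('a \<rightharpoonup> 'l) \<Rightarrow> bool" where
  "pattern G A p \<longleftrightarrow> finite (dom p) \<and> dom p \<subseteq> carrier G \<and> ran p \<subseteq> A"

definition avoiding_patterns ::
  "('a, 'm) monoid_scheme \<Rightarrow> 'l set \<Rightarrow> ('a \<rightharpoonup> 'l) set \<Rightarrow> ('a \<Rightarrow> 'l) set" where
  "avoiding_patterns G A F = {x \<in> full_shift G A. \<forall>p\<in>F. \<forall>g\<in>carrier G.
     \<not> (\<forall>h\<in>dom p. x \<in> cylinder G A (the (p h)) (g \<otimes>\<^bsub>G\<^esub> h))}"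

definition SFT :: "('a, 'm) monoid_scheme \<Rightarrow> 'l set \<Rightarrow> ('a \<Rightarrow> 'l) set \<Rightarrow> bool" where
  "SFT G A X \<longleftrightarrow> subshift G A X \<and>
     (\<exists>F. finite F \<and> (\<forall>p\<in>F. pattern G A p) \<and> X = avoiding_patterns G A F)"

text \<open>
  A definition cannot quantify over types, so the alphabet of the covering SFT is a finite
  set of naturals; every finite alphabet is of this form up to renaming letters.
\<close>

definition sofic :: "('a, 'm) monoid_scheme \<Rightarrow> 'l set \<Rightarrow> ('a \<Rightarrow> 'l) set \<Rightarrow> bool" where
  "sofic G A Y \<longleftrightarrow> subshift G A Y \<and>
     (\<exists>(B :: nat set) Z \<phi>. SFT G B Z \<and>
        continuous_map (subtopology (full_shift_topology G B) Z)
                       (subtopology (full_shift_topology G A) Y) \<phi> \<and>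
        \<phi> ` Z = Y \<and>
        (\<forall>g\<in>carrier G. \<forall>z\<in>Z. \<phi> (shift_action G g z) = shift_action G g (\<phi> z)))"

type_synonym ('a, 'l) coding = "('a list \<times> 'l) set"

definition pattern_coding :: "'a set \<Rightarrow> 'l set \<Rightarrow> ('a, 'l) coding \<Rightarrow> bool" where
  "pattern_coding S A c \<longleftrightarrow> finite c \<and> c \<subseteq> lists S \<times> A"

definition avoiding_codings ::
  "('a, 'm) monoid_scheme \<Rightarrow> 'l set \<Rightarrow> ('a, 'l) coding set \<Rightarrow> ('a \<Rightarrow> 'l) set" where
  "avoiding_codings G A \<C> = {x \<in> full_shift G A. \<forall>g\<in>carrier G. \<forall>c\<in>\<C>.
     \<not> (\<forall>(w, a)\<in>c. x \<in> cylinder G A a (g \<otimes>\<^bsub>G\<^esub> word_val G w))}"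

text \<open>
  Deterministic machines with a work tape and an oracle tape, both two-way infinite; \<open>None\<close> is
  the blank. In the state \<open>query\<close> the machine moves in one step, leaving tapes and heads
  unchanged, to the state \<open>yes\<close> or \<open>no\<close>, according to whether the content of the oracle tape is
  a word of the oracle set written from cell 0 onwards with all other cells blank. In every
  other state \<open>delta\<close> applies, reading the state, the work symbol and the oracle tape symbol.
\<close>

datatype move = MoveLeft | Stay | MoveRight

fun displace :: "move \<Rightarrow> int \<Rightarrow> int" where
  "displace MoveLeft i = i - 1"
| "displace Stay i = i"
| "displace MoveRight i = i + 1"

record 's oracle_machine =
  states :: "nat set"
  symbols :: "'s set"
  start :: nat
  query :: nat
  yes :: nat
  no :: nat
  accept :: nat
  delta :: "nat \<Rightarrow> 's option \<Rightarrow> 's option \<Rightarrow> nat \<times> ('s option \<times> move) \<times> ('s option \<times> move)"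

definition oracle_machine :: "'s oracle_machine \<Rightarrow> bool" where
  "oracle_machine M \<longleftrightarrow> finite (states M) \<and> finite (symbols M) \<and>
     {start M, query M, yes M, no M, accept M} \<subseteq> states M \<and>
     (let \<Gamma> = insert None (Some ` symbols M) in
      \<forall>q\<in>states M. \<forall>a\<in>\<Gamma>. \<forall>b\<in>\<Gamma>. delta M q a b \<in> states M \<times> (\<Gamma> \<times> UNIV) \<times> (\<Gamma> \<times> UNIV))"

type_synonym 's tape = "int \<Rightarrow> 's option"

definition tape_of :: "'s list \<Rightarrow> 's tape" where
  "tape_of w = (\<lambda>i. if 0 \<le> i \<and> i < int (length w) then Some (w ! nat i) else None)"

type_synonym 's mconfig = "nat \<times> ('s tape \<times> int) \<times> ('s tape \<times> int)"

fun oracle_step :: "'s list set \<Rightarrow> 's oracle_machine \<Rightarrow> 's mconfig \<Rightarrow> 's mconfig" where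
  "oracle_step W M (q, (t, i), (u, j)) =
     (if q = query M then (if u \<in> tape_of ` W then yes M else no M, (t, i), (u, j))
      else case delta M q (t i) (u j) of
        (q', (a, d), (b, e)) \<Rightarrow> (q', (t(i := a), displace d i), (u(j := b), displace e j)))"

definition accepts :: "'s list set \<Rightarrow> 's oracle_machine \<Rightarrow> 's list \<Rightarrow> bool" where
  "accepts W M w \<longleftrightarrow>
     (\<exists>n. fst ((oracle_step W M ^^ n) (start M, (tape_of w, 0), (tape_of [], 0))) = accept M)"

text \<open>
  Tape symbols: generators, letters of the alphabet, and an unlimited supply of auxiliary
  symbols. A list \<open>(w\<^sub>1, a\<^sub>1), \<dots>, (w\<^sub>k, a\<^sub>k)\<close> is written as the string \<open>w\<^sub>1 a\<^sub>1 \<dots> w\<^sub>k a\<^sub>k\<close>, which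
  is uniquely readable because letters are not generators.
\<close>

datatype 'a symbol = Generator 'a | Letter nat | Auxiliary nat

definition encode_coding :: "('a list \<times> nat) list \<Rightarrow> 'a symbol list" where
  "encode_coding cs = concat (map (\<lambda>(w, a). map Generator w @ [Letter a]) cs)"

text \<open>
  Recursive enumerability, with oracle the word problem: the members of \<open>\<C>\<close> are the codings
  described by the accepted lists. A finite set may be listed in several ways; it is only
  required that each member has some accepted listing, and that every accepted
  listing describes a member. As equality of finite sets given by lists is decidable, it makes no
  difference whether one or all listings of each member are accepted.
\<close>

definition word_problem_re ::
  "('a, 'm) monoid_scheme \<Rightarrow> 'a set \<Rightarrow> nat set \<Rightarrow> ('a, nat) coding set \<Rightarrow> bool" where
  "word_problem_re G S A \<C> \<longleftrightarrow>
     (\<exists>M :: 'a symbol oracle_machine. oracle_machine M \<and>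
        Generator ` S \<union> Letter ` A \<subseteq> symbols M \<and>
        \<C> = {set cs | cs. cs \<in> lists (lists S \<times> A) \<and>
                accepts (map Generator ` word_problem G S) M (encode_coding cs)})"

definition effectively_closed ::
  "('a, 'm) monoid_scheme \<Rightarrow> 'a set \<Rightarrow> nat set \<Rightarrow> ('a \<Rightarrow> nat) set \<Rightarrow> bool" where
  "effectively_closed G S A X \<longleftrightarrow> subshift G A X \<and>
     (\<exists>\<C>. (\<forall>c\<in>\<C>. pattern_coding S A c) \<and> word_problem_re G S A \<C> \<and> X = avoiding_codings G A \<C>)"

end

theory Submission
  imports Defs
begin

text \<open>
  The witness is a subshift of comparisons. Over the letters \<open>0, \<dots>, 4\<close>, a \<open>1\<close> at \<open>g\<close> and a \<open>2\<close> at \<open>k\<close>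
  act as two base points, and it is forbidden that some displacement \<open>b\<close> sees a \<open>3\<close> from the first
  base point and a \<open>4\<close> from the second one, that is, \<open>x (g b) = 3\<close> and \<open>x (k b) = 4\<close>. Thus the set
  of \<open>3\<close>s around one base point has to be compared with the set of \<open>4\<close>s around the other, however far
  apart they are.

  In a group with at least two ends a finite set of vertices separates two infinite parts of the Cayley
  graph. In purely group theoretic terms, there is an infinite set \<open>C\<close> with infinite complement that
  every right translation changes only in finitely many elements (\<open>ends_imp_almost_invariant\<close>). A
  sofic subshift can transmit only boundedly much information between \<open>C\<close> and its complement:
  among sufficiently many configurations, two distinct ones have covering configurations that agree on
  the finite set through which \<open>C\<close> and its complement interact, and then the left part of one can be
  glued to the right part of the other (\<open>sofic_splice\<close>). The comparison shift does not
  allow this. Both \<open>C\<close> and its complement contain a translate of every finite set \<open>P\<close>, so the base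
  points can be put on opposite sides; the position of a single \<open>3\<close> inside \<open>P\<close>, with \<open>4\<close>s at all the
  other positions of \<open>P\<close> on the opposite side, gives \<open>card P\<close> admissible configurations, and gluing any
  two of them creates a forbidden pattern (\<open>comparison_shift_not_sofic\<close>).

  The forbidden patterns are recognised with the word problem as oracle: a listing
  \<open>(\<epsilon>, 1), (u, 2), (v, 3), (w, 4)\<close> is forbidden iff \<open>u v w\<inverse>\<close> represents the identity. A machine with one
  forward pass, which copies \<open>u\<close> and \<open>v\<close> to the oracle tape, and one backward pass over \<open>w\<close>, which
  appends inverted generators, decides this with a single query (\<open>accepts_matcher\<close>).
\<close>

section \<open>Almost invariant sets\<close>

text \<open>
  If \<open>G\<close> is finitely generated, these are the sets of vertices of its Cayley graph that only finitely many
  edges leave; this form shows that the choice of the generators does not matter.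
\<close>

definition (in group) almost_invariant :: "'a set \<Rightarrow> bool" where
  "almost_invariant C \<longleftrightarrow> (\<forall>a\<in>carrier G. finite {h \<in> carrier G. h \<in> C \<longleftrightarrow> h \<otimes> a \<notin> C})"

context group
begin

lemma almost_invariant_Diff:
  assumes "almost_invariant C"
  shows "almost_invariant (carrier G - C)"
  unfolding almost_invariant_def
proof
  fix a assume a: "a \<in> carrier G"
  then have "{h \<in> carrier G. h \<in> carrier G - C \<longleftrightarrow> h \<otimes> a \<notin> carrier G - C} =
      {h \<in> carrier G. h \<in> C \<longleftrightarrow> h \<otimes> a \<notin> C}"
    by auto
  then show "finite {h \<in> carrier G. h \<in> carrier G - C \<longleftrightarrow> h \<otimes> a \<notin> carrier G - C}"
    using assms a by (simp add: almost_invariant_def)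
qed

text \<open>
  An infinite almost invariant set contains translates of every finite set, and they can avoid any
  given finite set: each \<open>b\<close> excludes only finitely many base points.
\<close>

lemma translate_inside:
  assumes D: "D \<subseteq> carrier G" "infinite D"
    and almost_inv: "almost_invariant D"
    and "finite K" and P: "finite P" "P \<subseteq> carrier G"
  obtains g where "g \<in> D" "\<And>b. b \<in> P \<Longrightarrow> g \<otimes> b \<in> D - K"
proof -
  have "finite {h \<in> carrier G. h \<otimes> b \<in> K}" if b: "b \<in> carrier G" for b
  proof (rule finite_subset)
    show "{h \<in> carrier G. h \<otimes> b \<in> K} \<subseteq> (\<lambda>k. k \<otimes> inv b) ` K"
    proof
      fix h assume h: "h \<in> {h \<in> carrier G. h \<otimes> b \<in> K}"
      then have "h = (h \<otimes> b) \<otimes> inv b" using b by (simp add: m_assoc)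
      then show "h \<in> (\<lambda>k. k \<otimes> inv b) ` K" using h by blast
    qed
  qed (use assms in simp)
  then have "finite (\<Union>b\<in>P. {h \<in> carrier G. h \<in> D \<longleftrightarrow> h \<otimes> b \<notin> D} \<union> {h \<in> carrier G. h \<otimes> b \<in> K})"
    using P almost_inv by (intro finite_UN_I finite_UnI) (auto simp: almost_invariant_def)
  then obtain g where "g \<in> D"
    "g \<notin> (\<Union>b\<in>P. {h \<in> carrier G. h \<in> D \<longleftrightarrow> h \<otimes> b \<notin> D} \<union> {h \<in> carrier G. h \<otimes> b \<in> K})"
    using D(2) by (meson finite_subset subsetI)
  then show ?thesis using D(1) by (intro that[of g]) auto
qed

end

section \<open>Words and group elements\<close>

locale symmetric_generators = group G for G :: "('a, 'm) monoid_scheme" (structure) +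
  fixes S :: "'a set"
  assumes finite_S: "finite S"
    and S_carrier: "S \<subseteq> carrier G"
    and generates: "generate G S = carrier G"
    and inv_S: "\<And>s. s \<in> S \<Longrightarrow> inv s \<in> S"
begin

lemma word_val_Nil [simp]: "word_val G [] = \<one>"
  and word_val_Cons [simp]: "word_val G (s # w) = s \<otimes> word_val G w"
  by (simp_all add: word_val_def)

lemma word_val_closed [simp]: "w \<in> lists S \<Longrightarrow> word_val G w \<in> carrier G"
  using S_carrier by (induction w) auto

lemma word_val_append:
  "u \<in> lists S \<Longrightarrow> v \<in> lists S \<Longrightarrow> word_val G (u @ v) = word_val G u \<otimes> word_val G v"
  using S_carrier by (induction u) (auto simp: m_assoc subset_iff)

lemma rev_map_inv_lists: "w \<in> lists S \<Longrightarrow> rev (map (\<lambda>s. inv s) w) \<in> lists S"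
  using inv_S by auto

lemma word_val_rev_map_inv:
  "w \<in> lists S \<Longrightarrow> word_val G (rev (map (\<lambda>s. inv s) w)) = inv (word_val G w)"
proof (induction w)
  case (Cons s w)
  then have "s \<in> S" "w \<in> lists S" by auto
  then have "s \<in> carrier G" "[inv s] \<in> lists S"
    using S_carrier inv_S by auto
  then show ?case
    using Cons.IH \<open>w \<in> lists S\<close> rev_map_inv_lists[OF \<open>w \<in> lists S\<close>]
    by (simp add: word_val_append inv_mult_group)
qed simp

lemma word_val_surj:
  assumes "g \<in> carrier G"
  obtains w where "w \<in> lists S" "word_val G w = g"
proof -
  from assms have "g \<in> generate G S" by (simp add: generates)
  then have "\<exists>w\<in>lists S. word_val G w = g"
  proof (induction rule: generate.induct)
    case one
    then show ?case by (intro bexI[of _ "[]"]) auto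
  next
    case (incl h)
    then show ?case using S_carrier by (intro bexI[of _ "[h]"]) auto
  next
    case (inv h)
    then show ?case using S_carrier inv_S by (intro bexI[of _ "[inv h]"]) auto
  next
    case (eng g h)
    then show ?case by (metis append_in_lists_conv word_val_append)
  qed
  then show ?thesis using that by blast
qed

section \<open>Ends and almost invariant sets\<close>

lemma cayley_adj_iff: "(g, h) \<in> cayley_adj G S \<longleftrightarrow> g \<in> carrier G \<and> (\<exists>s\<in>S. h = g \<otimes> s)"
proof
  assume "(g, h) \<in> cayley_adj G S"
  then obtain x s where x: "x \<in> carrier G" "s \<in> S" "{g, h} = {x, x \<otimes> s}"
    by (auto simp: cayley_adj_def cayley_edges_def)
  then consider "g = x" "h = x \<otimes> s" | "h = x" "g = x \<otimes> s"
    by (auto simp: doubleton_eq_iff)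
  then show "g \<in> carrier G \<and> (\<exists>s\<in>S. h = g \<otimes> s)"
  proof cases
    case 2
    then have "h = g \<otimes> inv s" using x S_carrier by (auto simp: m_assoc subset_iff)
    then show ?thesis using 2 x S_carrier inv_S by auto
  qed (use x in auto)
qed (auto simp: cayley_adj_def cayley_edges_def)

lemma sym_cayley_adj: "sym (cayley_adj G S)"
  by (auto simp: sym_def cayley_adj_def insert_commute)

lemma cayley_ball_Suc:
  "h \<in> cayley_ball G S n \<Longrightarrow> (h, g) \<in> cayley_adj G S \<Longrightarrow> g \<in> cayley_ball G S (Suc n)"
  unfolding cayley_ball_def using relpow_Suc_I by fastforce

lemma finite_cayley_sphere: "finite {g. (\<one>, g) \<in> cayley_adj G S ^^ k}"
proof (induction k)
  case (Suc k)
  have "{g. (\<one>, g) \<in> cayley_adj G S ^^ Suc k} \<subseteq>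
    (\<lambda>(h, s). h \<otimes> s) ` ({g. (\<one>, g) \<in> cayley_adj G S ^^ k} \<times> S)"
    by (fastforce elim!: relpow_Suc_E simp: cayley_adj_iff image_iff)
  then show ?case using Suc finite_S by (blast intro: finite_subset)
qed simp

lemma finite_cayley_ball: "finite (cayley_ball G S n)"
proof -
  have "cayley_ball G S n = (\<Union>k\<le>n. {g. (\<one>, g) \<in> cayley_adj G S ^^ k})"
    by (auto simp: cayley_ball_def)
  then show ?thesis using finite_cayley_sphere by simp
qed

lemma reachable_from_one:
  assumes "g \<in> carrier G"
  obtains k where "(\<one>, g) \<in> cayley_adj G S ^^ k"
proof -
  obtain w where w: "w \<in> lists S" "word_val G w = g"
    using word_val_surj assms by blast
  have "w \<in> lists S \<Longrightarrow> (\<one>, word_val G w) \<in> cayley_adj G S ^^ length w" for w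
  proof (induction w rule: rev_induct)
    case (snoc s w)
    then have "(word_val G w, word_val G (w @ [s])) \<in> cayley_adj G S"
      using S_carrier by (auto simp: cayley_adj_iff word_val_append subset_iff)
    then show ?case using snoc by (auto intro: relpow_Suc_I)
  qed simp
  then show ?thesis using that w by blast
qed

definition connected_within :: "'a set \<Rightarrow> ('a \<times> 'a) set" where
  "connected_within V = (cayley_adj G S \<inter> V \<times> V)\<^sup>*"

lemma equiv_connected_within: "equiv UNIV (connected_within V)"
proof -
  have "sym (cayley_adj G S \<inter> V \<times> V)"
    using sym_cayley_adj by (auto simp: sym_def)
  then show ?thesis
    unfolding connected_within_def
    by (auto intro!: equivI refl_rtrancl sym_rtrancl trans_rtrancl)
qed

lemma connected_within_subset: "x \<in> V \<Longrightarrow> connected_within V `` {x} \<subseteq> V"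
proof
  fix y assume "x \<in> V" "y \<in> connected_within V `` {x}"
  then have "(x, y) \<in> (cayley_adj G S \<inter> V \<times> V)\<^sup>*" by (simp add: connected_within_def)
  then show "y \<in> V" using \<open>x \<in> V\<close> by cases auto
qed

lemma cayley_components_subset: "C \<in> cayley_components G S V \<Longrightarrow> C \<subseteq> V"
  using connected_within_subset
  by (auto simp: cayley_components_def quotient_def connected_within_def)

lemma Union_cayley_components: "\<Union> (cayley_components G S V) = V"
  using cayley_components_subset
  by (auto simp: cayley_components_def quotient_def)

lemma cayley_components_disjoint:
  assumes "C \<in> cayley_components G S V" "D \<in> cayley_components G S V" "C \<noteq> D"
  shows "C \<inter> D = {}"
  using assms quotient_disj[OF equiv_connected_within, of C V D]
  by (auto simp: cayley_components_def connected_within_def quotient_def)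

lemma cayley_component_closed:
  assumes "C \<in> cayley_components G S V" "g \<in> C" "h \<in> V" "(g, h) \<in> cayley_adj G S"
  shows "h \<in> C"
proof -
  have "g \<in> V" using assms cayley_components_subset by blast
  then show ?thesis using assms
    by (auto simp: cayley_components_def quotient_def intro: rtrancl_into_rtrancl)
qed

text \<open>
  A path from a vertex outside the ball to the identity has to enter the ball, and the last vertex before
  this happens lies in the component it started in and in the next larger ball. Hence every component
  meets a fixed finite set.
\<close>

lemma finite_cayley_components: "finite (cayley_components G S (carrier G - cayley_ball G S n))"
proof -
  define V where "V = carrier G - cayley_ball G S n"
  have "\<one> \<in> cayley_ball G S n" by (auto simp: cayley_ball_def intro: exI[of _ 0])
  then have one: "\<one> \<notin> V" by (simp add: V_def)
  have reach: "\<exists>y\<in>cayley_ball G S (Suc n). (x, y) \<in> connected_within V"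
    if "(\<one>, x) \<in> cayley_adj G S ^^ k" "x \<in> V" for x k
    using that
  proof (induction k arbitrary: x)
    case 0
    then show ?case using one by simp
  next
    case (Suc k)
    then obtain h where h: "(\<one>, h) \<in> cayley_adj G S ^^ k" "(h, x) \<in> cayley_adj G S"
      by (auto elim: relpow_Suc_E)
    then have "h \<in> carrier G" by (simp add: cayley_adj_iff)
    show ?case
    proof (cases "h \<in> V")
      case True
      then obtain y where "y \<in> cayley_ball G S (Suc n)" "(h, y) \<in> connected_within V"
        using Suc h by blast
      moreover have "(x, h) \<in> cayley_adj G S \<inter> V \<times> V"
        using h True Suc.prems sym_cayley_adj by (auto dest: symD)
      ultimately show ?thesis
        unfolding connected_within_def by (blast intro: converse_rtrancl_into_rtrancl)
    next
      case False
      then have "x \<in> cayley_ball G S (Suc n)"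
        using \<open>h \<in> carrier G\<close> h cayley_ball_Suc by (auto simp: V_def)
      then show ?thesis unfolding connected_within_def by blast
    qed
  qed
  have "cayley_components G S V \<subseteq> (\<lambda>y. connected_within V `` {y}) ` cayley_ball G S (Suc n)"
  proof
    fix C assume "C \<in> cayley_components G S V"
    then obtain x where x: "x \<in> V" "C = connected_within V `` {x}"
      by (auto simp: cayley_components_def connected_within_def quotient_def)
    then obtain k where "(\<one>, x) \<in> cayley_adj G S ^^ k"
      using reachable_from_one by (auto simp: V_def)
    then obtain y where "y \<in> cayley_ball G S (Suc n)" "(x, y) \<in> connected_within V"
      using reach x by blast
    then show "C \<in> (\<lambda>y. connected_within V `` {y}) ` cayley_ball G S (Suc n)"
      using x equiv_class_eq[OF equiv_connected_within] by blast
  qed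
  then show ?thesis
    unfolding V_def by (rule finite_subset) (simp add: finite_cayley_ball)
qed

text \<open>
  The number of ends is a limit that is meaningful only if the sequence converges. If no ball left two
  infinite components, the sequence would be constant: \<open>0\<close> for a finite group, and \<open>1\<close> for an infinite
  one, because finitely many components cover an infinite set. So the limit would exist and be at most
  \<open>1\<close>.
\<close>

lemma two_infinite_components:
  assumes "number_of_ends G S \<ge> 2"
  obtains n C D where "C \<in> cayley_components G S (carrier G - cayley_ball G S n)"
    and "D \<in> cayley_components G S (carrier G - cayley_ball G S n)"
    and "infinite C" and "infinite D" and "C \<noteq> D"
proof -
  define I where "I n = {C \<in> cayley_components G S (carrier G - cayley_ball G S n). infinite C}" for n
  have "\<exists>n C D. C \<in> I n \<and> D \<in> I n \<and> C \<noteq> D"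
  proof (rule ccontr)
    assume "\<not> ?thesis"
    then have unique: "C = D" if "C \<in> I n" "D \<in> I n" for C D n
      using that by blast
    have "\<exists>k\<le>1. \<forall>n. card (I n) = k"
    proof (cases "finite (carrier G)")
      case True
      then have "I n = {}" for n
        using cayley_components_subset unfolding I_def by (blast intro: finite_subset)
      then show ?thesis by auto
    next
      case False
      have "card (I n) = 1" for n
      proof -
        have "infinite (carrier G - cayley_ball G S n)"
          using False finite_cayley_ball by simp
        then have "I n \<noteq> {}"
          using finite_cayley_components[of n] Union_cayley_components
          unfolding I_def by (metis (mono_tags, lifting) empty_Collect_eq finite_Union)
        then obtain C where "I n = {C}" using unique by blast
        then show ?thesis by simp
      qed
      then show ?thesis by auto
    qed
    then obtain k where "k \<le> 1" "\<And>n. card (I n) = k" by blast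
    then have "number_of_ends G S = enat k"
      unfolding number_of_ends_def I_def by (simp add: limI)
    then show False using assms \<open>k \<le> 1\<close> by (simp add: numeral_eq_enat)
  qed
  then show ?thesis using that unfolding I_def by blast
qed

text \<open>
  An infinite component \<open>C\<close> of the complement of a ball can be left along an edge only through the
  ball, so multiplication by a generator moves only finitely many elements across the border of \<open>C\<close>;
  this passes to products. The complement of \<open>C\<close> is infinite because it contains the second component.
\<close>

lemma ends_imp_almost_invariant:
  assumes "number_of_ends G S \<ge> 2"
  obtains C where "C \<subseteq> carrier G" "infinite C" "infinite (carrier G - C)" "almost_invariant C"
proof -
  obtain n C D where C: "C \<in> cayley_components G S (carrier G - cayley_ball G S n)"
    and D: "D \<in> cayley_components G S (carrier G - cayley_ball G S n)"
    and inf: "infinite C" "infinite D" "C \<noteq> D"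
    using two_infinite_components[OF assms] .
  have sub: "C \<subseteq> carrier G - cayley_ball G S n"
    using C by (rule cayley_components_subset)
  have "D \<subseteq> carrier G - C"
    using cayley_components_subset[OF D] cayley_components_disjoint[OF C D] inf by blast
  then have inf': "infinite (carrier G - C)"
    using inf by (blast dest: finite_subset)
  have crossing: "finite {h \<in> carrier G. h \<in> C \<longleftrightarrow> h \<otimes> s \<notin> C}" if s: "s \<in> S" for s
  proof (rule finite_subset)
    have s': "s \<in> carrier G" using s S_carrier by auto
    show "{h \<in> carrier G. h \<in> C \<longleftrightarrow> h \<otimes> s \<notin> C} \<subseteq>
      cayley_ball G S n \<union> (\<lambda>h. h \<otimes> inv s) ` cayley_ball G S n"
    proof
      fix h assume "h \<in> {h \<in> carrier G. h \<in> C \<longleftrightarrow> h \<otimes> s \<notin> C}"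
      then have h: "h \<in> carrier G" "h \<in> C \<longleftrightarrow> h \<otimes> s \<notin> C" by auto
      have adj: "(h, h \<otimes> s) \<in> cayley_adj G S"
        using h s by (auto simp: cayley_adj_iff)
      note adj = adj symD[OF sym_cayley_adj adj]
      have "h \<in> cayley_ball G S n \<or> h \<otimes> s \<in> cayley_ball G S n"
        using cayley_component_closed[OF C] adj h s' by blast
      moreover have "h = (h \<otimes> s) \<otimes> inv s" using h s' by (simp add: m_assoc)
      ultimately show "h \<in> cayley_ball G S n \<union> (\<lambda>h. h \<otimes> inv s) ` cayley_ball G S n"
        by blast
    qed
  qed (use finite_cayley_ball in auto)
  have word: "finite {h \<in> carrier G. h \<in> C \<longleftrightarrow> h \<otimes> word_val G w \<notin> C}" if "w \<in> lists S" for w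
    using that
  proof (induction w)
    case Nil
    have "{h \<in> carrier G. h \<in> C \<longleftrightarrow> h \<otimes> word_val G [] \<notin> C} = {}" by auto
    then show ?case by (simp only: finite.emptyI)
  next
    case (Cons s w)
    then have s: "s \<in> S" "s \<in> carrier G" "w \<in> lists S" using S_carrier by auto
    let ?E = "{h \<in> carrier G. h \<in> C \<longleftrightarrow> h \<otimes> word_val G w \<notin> C}"
    have "{h \<in> carrier G. h \<in> C \<longleftrightarrow> h \<otimes> word_val G (s # w) \<notin> C} \<subseteq>
      {h \<in> carrier G. h \<in> C \<longleftrightarrow> h \<otimes> s \<notin> C} \<union> (\<lambda>h. h \<otimes> inv s) ` ?E"
    proof
      fix h assume "h \<in> {h \<in> carrier G. h \<in> C \<longleftrightarrow> h \<otimes> word_val G (s # w) \<notin> C}"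
      then have h: "h \<in> carrier G" "h \<in> C \<longleftrightarrow> (h \<otimes> s) \<otimes> word_val G w \<notin> C"
        using s by (auto simp: m_assoc)
      have "h = (h \<otimes> s) \<otimes> inv s" using h s by (simp add: m_assoc)
      moreover have "h \<otimes> s \<in> carrier G" using h s by simp
      ultimately show "h \<in> {h \<in> carrier G. h \<in> C \<longleftrightarrow> h \<otimes> s \<notin> C} \<union> (\<lambda>h. h \<otimes> inv s) ` ?E"
        using h by blast
    qed
    then show ?case using crossing[OF s(1)] Cons.IH s by (meson finite_UnI finite_imageI finite_subset)
  qed
  show ?thesis
  proof (rule that)
    show "almost_invariant C"
      unfolding almost_invariant_def
    proof
      fix a assume "a \<in> carrier G"
      then obtain w where "w \<in> lists S" "word_val G w = a" by (rule word_val_surj)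
      then show "finite {h \<in> carrier G. h \<in> C \<longleftrightarrow> h \<otimes> a \<notin> C}" using word by blast
    qed
  qed (use sub inf inf' in auto)
qed

end

section \<open>Gluing configurations of a sofic subshift\<close>

lemma topspace_full_shift_topology [simp]: "topspace (full_shift_topology G A) = full_shift G A"
  by (simp add: full_shift_topology_def full_shift_def)

text \<open>
  Around each point a continuous map to a discrete space is constant on a box restricting finitely many
  coordinates. Finitely many boxes suffice by compactness, and the coordinates restricted by
  any of them determine the value.
\<close>

lemma continuous_depends_on_finitely_many:
  assumes "finite B"
    and Z: "closedin (product_topology (\<lambda>_. discrete_topology B) I) Z"
    and f: "continuous_map (subtopology (product_topology (\<lambda>_. discrete_topology B) I) Z)
              (discrete_topology A) f"
  obtains M where "finite M" "M \<subseteq> I"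
    "\<And>z z'. z \<in> Z \<Longrightarrow> z' \<in> Z \<Longrightarrow> (\<And>m. m \<in> M \<Longrightarrow> z m = z' m) \<Longrightarrow> f z = f z'"
proof -
  let ?P = "product_topology (\<lambda>_. discrete_topology B) I"
  have sub: "Z \<subseteq> I \<rightarrow>\<^sub>E B" using closedin_subset[OF Z] by simp
  have "compact_space ?P"
    using assms(1) by (simp add: compact_space_product_topology compact_space_discrete_topology)
  then have comp: "compactin ?P Z" using Z by (rule closedin_compact_space)
  define local_box where "local_box z U \<longleftrightarrow> finite {i \<in> I. U i \<noteq> B} \<and> (\<forall>i\<in>I. U i \<subseteq> B) \<and>
      z \<in> PiE I U \<and> (\<forall>y\<in>Z \<inter> PiE I U. f y = f z)" for z U
  have "\<exists>U. local_box z U" if z: "z \<in> Z" for z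
  proof -
    have "f z \<in> A" using continuous_map_image_subset_topspace[OF f] z sub by auto
    then have "openin (subtopology ?P Z) {y \<in> topspace (subtopology ?P Z). f y \<in> {f z}}"
      by (intro openin_continuous_map_preimage[OF f]) simp
    then obtain V where V: "openin ?P V" "{y \<in> topspace (subtopology ?P Z). f y \<in> {f z}} = V \<inter> Z"
      by (auto simp: openin_subtopology)
    then have "z \<in> V" using z sub by auto
    then obtain U where "finite {i \<in> I. U i \<noteq> B}" "\<forall>i\<in>I. U i \<subseteq> B" "z \<in> PiE I U" "PiE I U \<subseteq> V"
      using V(1) by (auto simp: openin_product_topology_alt)
    moreover have "\<forall>y\<in>Z \<inter> PiE I U. f y = f z"
      using V(2) \<open>PiE I U \<subseteq> V\<close> by blast
    ultimately show ?thesis unfolding local_box_def by blast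
  qed
  then obtain U where "\<And>z. z \<in> Z \<Longrightarrow> local_box z (U z)" by metis
  then have U: "finite {i \<in> I. U z i \<noteq> B}" "\<forall>i\<in>I. U z i \<subseteq> B"
      "z \<in> PiE I (U z)" "\<And>y. y \<in> Z \<Longrightarrow> y \<in> PiE I (U z) \<Longrightarrow> f y = f z" if "z \<in> Z" for z
    using that unfolding local_box_def by blast+
  have "openin ?P (PiE I (U z))" if "z \<in> Z" for z
    using U[OF that] by (auto simp: openin_PiE_gen)
  moreover have "Z \<subseteq> \<Union> ((\<lambda>z. PiE I (U z)) ` Z)"
    using U(3) by blast
  ultimately have "\<exists>\<D>. finite \<D> \<and> \<D> \<subseteq> (\<lambda>z. PiE I (U z)) ` Z \<and> Z \<subseteq> \<Union> \<D>"
    by (intro compactinD[OF comp]) auto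
  then obtain D where D: "finite D" "D \<subseteq> Z" "Z \<subseteq> (\<Union>z\<in>D. PiE I (U z))"
    by (metis finite_subset_image)
  show ?thesis
  proof (rule that)
    show "finite (\<Union>z\<in>D. {i \<in> I. U z i \<noteq> B})" using D U by auto
    show "(\<Union>z\<in>D. {i \<in> I. U z i \<noteq> B}) \<subseteq> I" by auto
    fix z z' assume z: "z \<in> Z" "z' \<in> Z"
      and eq: "\<And>m. m \<in> (\<Union>z\<in>D. {i \<in> I. U z i \<noteq> B}) \<Longrightarrow> z m = z' m"
    obtain d where d: "d \<in> D" "z \<in> PiE I (U d)" using D z by blast
    have "z' i \<in> U d i" if "i \<in> I" for i
    proof (cases "U d i = B")
      case True
      then show ?thesis using z sub that by auto
    next
      case False
      then have "z i = z' i" using eq d that by blast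
      then show ?thesis using d that by (metis PiE_mem)
    qed
    then have "z' \<in> PiE I (U d)" using z sub by (auto simp: PiE_iff)
    moreover have "d \<in> Z" using d D by auto
    ultimately show "f z = f z'" using U(4)[OF \<open>d \<in> Z\<close>] d z by metis
  qed
qed

context group
begin

lemma shift_action_closed:
  "g \<in> carrier G \<Longrightarrow> x \<in> full_shift G A \<Longrightarrow> shift_action G g x \<in> full_shift G A"
  by (auto simp: full_shift_def shift_action_def)

text \<open>
  The compactness half of the Curtis--Hedlund--Lyndon theorem: continuity gives a finite window for the
  value at the identity, and equivariance carries the window to every other element.
\<close>

lemma sliding_block_window:
  assumes B: "finite B" and Z: "subshift G B Z" and Y: "subshift G A Y"
    and cont: "continuous_map (subtopology (full_shift_topology G B) Z)
                 (subtopology (full_shift_topology G A) Y) \<phi>"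
    and equi: "\<And>g z. g \<in> carrier G \<Longrightarrow> z \<in> Z \<Longrightarrow>
                 \<phi> (shift_action G g z) = shift_action G g (\<phi> z)"
  obtains M where "finite M" "M \<subseteq> carrier G"
    "\<And>g z z'. g \<in> carrier G \<Longrightarrow> z \<in> Z \<Longrightarrow> z' \<in> Z \<Longrightarrow>
       (\<And>m. m \<in> M \<Longrightarrow> z (g \<otimes> m) = z' (g \<otimes> m)) \<Longrightarrow> \<phi> z g = \<phi> z' g"
proof -
  have cl: "closedin (product_topology (\<lambda>_. discrete_topology B) (carrier G)) Z"
    using Z by (simp add: subshift_def full_shift_topology_def)
  have "continuous_map (full_shift_topology G A) (discrete_topology A) (\<lambda>x. x \<one>)"
    unfolding full_shift_topology_def by (rule continuous_map_product_projection) simp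
  then have "continuous_map (subtopology (full_shift_topology G A) Y) (discrete_topology A) (\<lambda>x. x \<one>)"
    by (rule continuous_map_from_subtopology)
  then have "continuous_map (subtopology (product_topology (\<lambda>_. discrete_topology B) (carrier G)) Z)
      (discrete_topology A) (\<lambda>z. \<phi> z \<one>)"
    using continuous_map_compose[OF cont] by (simp add: o_def full_shift_topology_def)
  then obtain M where M: "finite M" "M \<subseteq> carrier G"
    "\<And>z z'. z \<in> Z \<Longrightarrow> z' \<in> Z \<Longrightarrow> (\<And>m. m \<in> M \<Longrightarrow> z m = z' m) \<Longrightarrow> \<phi> z \<one> = \<phi> z' \<one>"
    using continuous_depends_on_finitely_many[OF B cl] by blast
  have at_one: "\<phi> z g = \<phi> (shift_action G (inv g) z) \<one>" if "g \<in> carrier G" "z \<in> Z" for g z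
    using that equi[of "inv g" z] by (simp add: shift_action_def)
  show ?thesis
  proof (rule that[OF M(1,2)])
    fix g z z' assume g: "g \<in> carrier G" and z: "z \<in> Z" "z' \<in> Z"
      and eq: "\<And>m. m \<in> M \<Longrightarrow> z (g \<otimes> m) = z' (g \<otimes> m)"
    have "\<phi> (shift_action G (inv g) z) \<one> = \<phi> (shift_action G (inv g) z') \<one>"
    proof (rule M(3))
      show "shift_action G (inv g) z \<in> Z" "shift_action G (inv g) z' \<in> Z"
        using Z g z by (auto simp: subshift_def)
      show "shift_action G (inv g) z m = shift_action G (inv g) z' m" if "m \<in> M" for m
        using eq[OF that] M(2) that g by (auto simp: shift_action_def)
    qed
    then show "\<phi> z g = \<phi> z' g" using at_one g z by simp
  qed
qed

text \<open>
  Membership in a subshift of finite type is a local condition: it suffices that the configuration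
  agrees, on each translate of the supports of the forbidden patterns, with one of two admissible
  configurations, possibly a different one for different translates.
\<close>

lemma SFT_splice:
  assumes z: "z \<in> avoiding_patterns G B F" "z' \<in> avoiding_patterns G B F"
    and y: "y \<in> full_shift G B"
    and agrees: "\<And>g. g \<in> carrier G \<Longrightarrow>
      (\<forall>p\<in>F. \<forall>h\<in>dom p. y (g \<otimes> h) = z (g \<otimes> h)) \<or> (\<forall>p\<in>F. \<forall>h\<in>dom p. y (g \<otimes> h) = z' (g \<otimes> h))"
  shows "y \<in> avoiding_patterns G B F"
proof -
  have "\<not> (\<forall>h\<in>dom p. y \<in> cylinder G B (the (p h)) (g \<otimes> h))" if p: "p \<in> F" and g: "g \<in> carrier G" for p g
  proof
    assume occ: "\<forall>h\<in>dom p. y \<in> cylinder G B (the (p h)) (g \<otimes> h)"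
    have "\<not> (\<forall>h\<in>dom p. y (g \<otimes> h) = x (g \<otimes> h))" if "x \<in> avoiding_patterns G B F" for x
    proof
      assume "\<forall>h\<in>dom p. y (g \<otimes> h) = x (g \<otimes> h)"
      then have "\<forall>h\<in>dom p. x \<in> cylinder G B (the (p h)) (g \<otimes> h)"
        using occ that by (auto simp: cylinder_def avoiding_patterns_def)
      then show False using that p g unfolding avoiding_patterns_def by blast
    qed
    then show False using agrees[OF g] z p by metis
  qed
  then show ?thesis using y by (auto simp: avoiding_patterns_def)
qed

text \<open>
  Limited transmission across an almost invariant set. A translate of the window \<open>W\<close> that meets both
  \<open>C\<close> and its complement lies entirely in a finite set \<open>K\<close>. So two configurations of the cover that
  agree on \<open>K\<close> can be glued along \<open>C\<close>, and the images are glued accordingly outside \<open>K\<close>. There are only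
  finitely many patterns on \<open>K\<close>, whence \<open>N\<close>.
\<close>

lemma sofic_splice:
  assumes Y: "sofic G A Y" and C: "C \<subseteq> carrier G"
    and almost_inv: "almost_invariant C"
  obtains K N where "finite K"
    "\<And>T. T \<subseteq> Y \<Longrightarrow> card T > N \<Longrightarrow> \<exists>x\<in>T. \<exists>x'\<in>T. \<exists>y\<in>Y. x \<noteq> x' \<and>
       (\<forall>g\<in>C - K. y g = x g) \<and> (\<forall>g\<in>carrier G - C - K. y g = x' g)"
proof -
  obtain B :: "nat set" and Z \<phi> where Z: "SFT G B Z" and \<phi>: "\<phi> ` Z = Y"
    and cont: "continuous_map (subtopology (full_shift_topology G B) Z)
                 (subtopology (full_shift_topology G A) Y) \<phi>"
    and equi: "\<And>g z. g \<in> carrier G \<Longrightarrow> z \<in> Z \<Longrightarrow>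
                 \<phi> (shift_action G g z) = shift_action G g (\<phi> z)"
    using Y unfolding sofic_def by blast
  have sub: "subshift G B Z" and B: "finite B"
    using Z by (auto simp: SFT_def subshift_def)
  have full: "Z \<subseteq> full_shift G B"
    using sub closedin_subset by (fastforce simp: subshift_def)
  have "subshift G A Y" using Y by (simp add: sofic_def)
  from sliding_block_window[OF B sub this cont equi]
  obtain M where M: "finite M" "M \<subseteq> carrier G"
    and block: "\<And>g z z'. g \<in> carrier G \<Longrightarrow> z \<in> Z \<Longrightarrow> z' \<in> Z \<Longrightarrow>
       (\<And>m. m \<in> M \<Longrightarrow> z (g \<otimes> m) = z' (g \<otimes> m)) \<Longrightarrow> \<phi> z g = \<phi> z' g"
    by blast
  obtain F where F: "finite F" "\<And>p. p \<in> F \<Longrightarrow> pattern G B p" "Z = avoiding_patterns G B F"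
    using Z unfolding SFT_def by blast
  \<comment> \<open>The identity is included so that a translate of the window contains its base point.\<close>
  define W where "W = insert \<one> (M \<union> \<Union> (dom ` F))"
  have W: "finite W" "W \<subseteq> carrier G" "\<one> \<in> W"
    using M F(1) F(2) by (auto simp: W_def pattern_def)
  define K where "K = (\<Union>(f, f')\<in>W \<times> W. {h \<in> carrier G. h \<in> C \<longleftrightarrow> h \<otimes> (inv f \<otimes> f') \<notin> C})"
  have finK: "finite K"
    unfolding K_def using W almost_inv by (intro finite_UN_I) (auto simp: almost_invariant_def subset_iff)
  have K: "K \<subseteq> carrier G" by (auto simp: K_def)
  have crossing: "g \<otimes> f \<in> K"
    if "g \<in> carrier G" "f \<in> W" "f' \<in> W" "g \<otimes> f \<in> C \<longleftrightarrow> g \<otimes> f' \<notin> C" for g f f'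
  proof -
    have "f \<in> carrier G" "f' \<in> carrier G" using that W by auto
    then have "(g \<otimes> f) \<otimes> (inv f \<otimes> f') = g \<otimes> f'"
      using that(1) by (metis inv_closed inv_solve_left m_assoc m_closed)
    then show ?thesis using that \<open>f \<in> carrier G\<close> unfolding K_def
      by (intro UN_I[of "(f, f')"]) auto
  qed
  have splice: "\<exists>y\<in>Y. (\<forall>g\<in>C - K. y g = \<phi> z g) \<and> (\<forall>g\<in>carrier G - C - K. y g = \<phi> z' g)"
    if z: "z \<in> Z" "z' \<in> Z" and eq: "\<And>h. h \<in> K \<Longrightarrow> z h = z' h" for z z'
  proof -
    define y where "y = (\<lambda>h\<in>carrier G. if h \<in> C then z h else z' h)"
    have "y \<in> full_shift G B"
      using subsetD[OF full z(1)] subsetD[OF full z(2)] by (auto simp: y_def full_shift_def)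
    have left: "y (g \<otimes> f) = z (g \<otimes> f)"
      if "g \<in> carrier G" "f \<in> W" "f' \<in> W" "g \<otimes> f' \<in> C" for g f f'
      using crossing[of g f f'] eq that W by (auto simp: y_def subset_iff)
    have right: "y (g \<otimes> f) = z' (g \<otimes> f)"
      if "g \<in> carrier G" "f \<in> W" "f' \<in> W" "g \<otimes> f' \<notin> C" for g f f'
      using crossing[of g f f'] eq that W by (auto simp: y_def subset_iff)
    have "y \<in> Z"
      unfolding F(3)
    proof (rule SFT_splice[where z = z and z' = z'])
      fix g assume g: "g \<in> carrier G"
      have "(\<forall>h\<in>W. y (g \<otimes> h) = z (g \<otimes> h)) \<or> (\<forall>h\<in>W. y (g \<otimes> h) = z' (g \<otimes> h))"
        using left[OF g _ W(3)] right[OF g _ W(3)] by blast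
      then show "(\<forall>p\<in>F. \<forall>h\<in>dom p. y (g \<otimes> h) = z (g \<otimes> h)) \<or>
          (\<forall>p\<in>F. \<forall>h\<in>dom p. y (g \<otimes> h) = z' (g \<otimes> h))"
        unfolding W_def by blast
    qed (use z F(3) \<open>y \<in> full_shift G B\<close> in auto)
    have "\<phi> y g = \<phi> z g" if "g \<in> C" for g
    proof (rule block)
      show "y (g \<otimes> m) = z (g \<otimes> m)" if "m \<in> M" for m
        using left[of g m \<one>] that \<open>g \<in> C\<close> C W by (auto simp: W_def)
    qed (use that C z \<open>y \<in> Z\<close> in auto)
    moreover have "\<phi> y g = \<phi> z' g" if "g \<in> carrier G - C" for g
    proof (rule block)
      show "y (g \<otimes> m) = z' (g \<otimes> m)" if "m \<in> M" for m
        using right[of g m \<one>] that \<open>g \<in> carrier G - C\<close> W by (auto simp: W_def)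
    qed (use that z \<open>y \<in> Z\<close> in auto)
    ultimately show ?thesis using \<open>y \<in> Z\<close> \<phi> by blast
  qed
  show ?thesis
  proof (rule that[OF finK])
    fix T assume T: "T \<subseteq> Y" "card T > card (K \<rightarrow>\<^sub>E B)"
    define \<zeta> where "\<zeta> = inv_into Z \<phi>"
    have \<zeta>: "\<zeta> x \<in> Z" "\<phi> (\<zeta> x) = x" if "x \<in> T" for x
      using that T \<phi> by (auto simp: \<zeta>_def inv_into_into f_inv_into_f)
    have "(\<lambda>x. restrict (\<zeta> x) K) ` T \<subseteq> K \<rightarrow>\<^sub>E B"
      using \<zeta>(1) full K by (fastforce simp: full_shift_def)
    then have "card ((\<lambda>x. restrict (\<zeta> x) K) ` T) \<le> card (K \<rightarrow>\<^sub>E B)"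
      using finK B by (intro card_mono finite_PiE) auto
    then have "\<not> inj_on (\<lambda>x. restrict (\<zeta> x) K) T"
      using T(2) by (intro pigeonhole) simp
    then obtain x x' where x: "x \<in> T" "x' \<in> T" "x \<noteq> x'" "restrict (\<zeta> x) K = restrict (\<zeta> x') K"
      by (auto simp: inj_on_def)
    then have "\<And>h. h \<in> K \<Longrightarrow> \<zeta> x h = \<zeta> x' h" by (metis restrict_apply')
    then show "\<exists>x\<in>T. \<exists>x'\<in>T. \<exists>y\<in>Y. x \<noteq> x' \<and>
       (\<forall>g\<in>C - K. y g = x g) \<and> (\<forall>g\<in>carrier G - C - K. y g = x' g)"
      using splice[OF \<zeta>(1) \<zeta>(1), of x x'] x \<zeta>(2) by metis
  qed
qed

section \<open>A shift comparing two distant patterns\<close>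

text \<open>
  The base points marked \<open>1\<close> and \<open>2\<close> are \<open>g\<close> and \<open>g a\<close>; a displacement \<open>b\<close> must not lead from the first to
  a \<open>3\<close> and from the second to a \<open>4\<close>. Using different letters for the two sets means that
  the relation never compares a set with a part of itself, whatever the position of the base points.
\<close>

definition comparison_shift :: "('a \<Rightarrow> nat) set" where
  "comparison_shift = {x \<in> full_shift G {..4}. \<forall>g\<in>carrier G. \<forall>a\<in>carrier G. \<forall>b\<in>carrier G.
     \<not> (x g = 1 \<and> x (g \<otimes> a) = 2 \<and> x (g \<otimes> b) = 3 \<and> x (g \<otimes> a \<otimes> b) = 4)}"

text \<open>
  The configurations \<open>marked v\<close> form a fooling set: \<open>v\<close> ranges over a large finite set \<open>P\<close>, whose
  translates \<open>g\<^sub>1 P\<close> and \<open>g\<^sub>2 P\<close> lie on opposite sides of the border. Each is admissible as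
  the \<open>4\<close>s around \<open>g\<^sub>2\<close> leave out exactly the displacement of the \<open>3\<close> around \<open>g\<^sub>1\<close>. Gluing those
  for \<open>v\<close> and \<open>w \<noteq> v\<close> puts both a \<open>3\<close> and a \<open>4\<close> at displacement \<open>v\<close>.
\<close>

lemma comparison_shift_not_sofic:
  assumes C: "C \<subseteq> carrier G" "infinite C" "infinite (carrier G - C)"
    and almost_inv: "almost_invariant C"
  shows "\<not> sofic G {..4} comparison_shift"
proof
  assume "sofic G {..4} comparison_shift"
  from sofic_splice[OF this C(1) almost_inv]
  obtain K N where K: "finite K"
    and splice: "\<And>T. T \<subseteq> comparison_shift \<Longrightarrow> card T > N \<Longrightarrow> \<exists>x\<in>T. \<exists>x'\<in>T. \<exists>y\<in>comparison_shift. x \<noteq> x' \<and>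
       (\<forall>g\<in>C - K. y g = x g) \<and> (\<forall>g\<in>carrier G - C - K. y g = x' g)"
    by metis
  \<comment> \<open>The identity is kept out of \<open>P\<close> because the base points carry letters of their own.\<close>
  have "infinite (carrier G - {\<one>})" using C by (auto dest: finite_subset)
  then obtain P where P: "finite P" "card P = Suc N" "P \<subseteq> carrier G - {\<one>}"
    by (metis infinite_arbitrarily_large)
  have Pc: "finite (insert \<one> P)" "insert \<one> P \<subseteq> carrier G" using P by auto
  obtain g\<^sub>1 where g1: "g\<^sub>1 \<in> C" "\<And>b. b \<in> insert \<one> P \<Longrightarrow> g\<^sub>1 \<otimes> b \<in> C - K"
    using translate_inside[OF C(1,2) almost_inv K Pc] by blast
  have "almost_invariant (carrier G - C)"
    using almost_inv by (rule almost_invariant_Diff)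
  then obtain g\<^sub>2 where g2: "g\<^sub>2 \<in> carrier G - C"
      "\<And>b. b \<in> insert \<one> P \<Longrightarrow> g\<^sub>2 \<otimes> b \<in> carrier G - C - K"
    using translate_inside[OF Diff_subset C(3) _ K Pc] by metis
  have car: "g\<^sub>1 \<in> carrier G" "g\<^sub>2 \<in> carrier G" using g1 g2 C by auto
  have g1_mem: "g\<^sub>1 \<in> C - K" and g2_mem: "g\<^sub>2 \<in> carrier G - C - K"
    using g1(2)[of \<one>] g2(2)[of \<one>] car by auto
  have P_car: "b \<in> carrier G" and P_one: "b \<noteq> \<one>" if "b \<in> P" for b
    using that P by auto
  define marked where "marked v = (\<lambda>h\<in>carrier G.
    if h = g\<^sub>1 then 1 else if h = g\<^sub>2 then 2 else if h = g\<^sub>1 \<otimes> v then 3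
    else if h \<in> (\<lambda>b. g\<^sub>2 \<otimes> b) ` (P - {v}) then 4 else 0 :: nat)" for v
  have marked_1: "marked v g\<^sub>1 = 1" and marked_2: "marked v g\<^sub>2 = 2" for v
    using car g1 g2 by (auto simp: marked_def)
  have marked_3: "marked v (g\<^sub>1 \<otimes> b) = 3 \<longleftrightarrow> b = v" if "v \<in> P" "b \<in> P" for v b
  proof -
    have "g\<^sub>1 \<otimes> b \<noteq> g\<^sub>1" "g\<^sub>1 \<otimes> b \<noteq> g\<^sub>2" "g\<^sub>1 \<otimes> b = g\<^sub>1 \<otimes> v \<longleftrightarrow> b = v"
      using that car P_car P_one g1(2)[of b] g2(1) by (auto simp: r_cancel_one)
    then show ?thesis using that car P_car by (auto simp: marked_def)
  qed
  have marked_4: "marked v (g\<^sub>2 \<otimes> b) = 4" if "v \<in> P" "b \<in> P" "b \<noteq> v" for v b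
  proof -
    have "g\<^sub>2 \<otimes> b \<noteq> g\<^sub>1" "g\<^sub>2 \<otimes> b \<noteq> g\<^sub>2" "g\<^sub>2 \<otimes> b \<noteq> g\<^sub>1 \<otimes> v"
      using that car P_car P_one g1(1) g1(2)[of v] g2(2)[of b] by auto
    then show ?thesis using that car P_car by (auto simp: marked_def)
  qed
  have marked_in: "marked v \<in> comparison_shift" if v: "v \<in> P" for v
  proof -
    have "\<not> (marked v g = 1 \<and> marked v (g \<otimes> a) = 2 \<and> marked v (g \<otimes> b) = 3 \<and>
        marked v (g \<otimes> a \<otimes> b) = 4)"
      if "g \<in> carrier G" "a \<in> carrier G" "b \<in> carrier G" for g a b
    proof
      assume m: "marked v g = 1 \<and> marked v (g \<otimes> a) = 2 \<and> marked v (g \<otimes> b) = 3 \<and>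
        marked v (g \<otimes> a \<otimes> b) = 4"
      then have "g = g\<^sub>1" "g \<otimes> a = g\<^sub>2" "g \<otimes> b = g\<^sub>1 \<otimes> v"
        "g \<otimes> a \<otimes> b \<in> (\<lambda>b. g\<^sub>2 \<otimes> b) ` (P - {v})"
        using that by (auto simp: marked_def split: if_splits)
      then have "b = v" "g\<^sub>2 \<otimes> b \<in> (\<lambda>b. g\<^sub>2 \<otimes> b) ` (P - {v})"
        using that car P_car v by auto
      then show False using car P_car v by auto
    qed
    moreover have "marked v \<in> full_shift G {..4}"
      by (auto simp: marked_def full_shift_def)
    ultimately show ?thesis by (simp add: comparison_shift_def)
  qed
  have "inj_on marked P"
    by (rule inj_onI) (metis marked_3)
  then have "card (marked ` P) > N" using P by (simp add: card_image)
  then obtain v w y where vw: "v \<in> P" "w \<in> P" "v \<noteq> w" and y: "y \<in> comparison_shift"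
    "\<forall>g\<in>C - K. y g = marked v g" "\<forall>g\<in>carrier G - C - K. y g = marked w g"
    using splice[of "marked ` P"] marked_in by blast
  have "y g\<^sub>1 = 1" "y g\<^sub>2 = 2" "y (g\<^sub>1 \<otimes> v) = 3" "y (g\<^sub>2 \<otimes> v) = 4"
    using y(2,3) vw g1_mem g2_mem g1(2)[of v] g2(2)[of v] marked_1 marked_2 marked_3 marked_4 by auto
  moreover have "g\<^sub>2 = g\<^sub>1 \<otimes> (inv g\<^sub>1 \<otimes> g\<^sub>2)"
    using car by (simp add: m_assoc[symmetric])
  ultimately have "y g\<^sub>1 = 1 \<and> y (g\<^sub>1 \<otimes> (inv g\<^sub>1 \<otimes> g\<^sub>2)) = 2 \<and> y (g\<^sub>1 \<otimes> v) = 3 \<and>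
      y (g\<^sub>1 \<otimes> (inv g\<^sub>1 \<otimes> g\<^sub>2) \<otimes> v) = 4"
    by metis
  moreover have "inv g\<^sub>1 \<otimes> g\<^sub>2 \<in> carrier G" "v \<in> carrier G" using car vw P_car by auto
  ultimately show False using y(1) car(1) unfolding comparison_shift_def by blast
qed

end

section \<open>A machine recognising the forbidden patterns\<close>

definition reaches_accept :: "'s list set \<Rightarrow> 's oracle_machine \<Rightarrow> 's mconfig \<Rightarrow> bool" where
  "reaches_accept W M c \<longleftrightarrow> (\<exists>n. fst ((oracle_step W M ^^ n) c) = accept M)"

lemma reaches_accept_step:
  assumes "fst c \<noteq> accept M"
  shows "reaches_accept W M c \<longleftrightarrow> reaches_accept W M (oracle_step W M c)"
proof
  assume "reaches_accept W M c"
  then obtain n where n: "fst ((oracle_step W M ^^ n) c) = accept M"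
    by (auto simp: reaches_accept_def)
  with assms obtain m where "n = Suc m" by (cases n) auto
  with n show "reaches_accept W M (oracle_step W M c)"
    by (auto simp: reaches_accept_def funpow_swap1)
next
  assume "reaches_accept W M (oracle_step W M c)"
  then show "reaches_accept W M c"
    unfolding reaches_accept_def by (metis comp_apply funpow_Suc_right)
qed

text \<open>
  Used for the rejecting state, in which the machine stays for ever.
\<close>

lemma not_reaches_accept_fixed:
  assumes "oracle_step W M c = c" "fst c \<noteq> accept M"
  shows "\<not> reaches_accept W M c"
proof -
  have "(oracle_step W M ^^ n) c = c" for n by (induction n) (use assms in auto)
  then show ?thesis using assms by (simp add: reaches_accept_def)
qed

lemma inj_tape_of: "inj tape_of"
proof (rule injI)
  fix v w :: "'s list" assume eq: "tape_of v = tape_of w"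
  have nth: "tape_of u (int i) = (if i < length u then Some (u ! i) else None)" for u :: "'s list" and i
    by (simp add: tape_of_def)
  have *: "(if i < length v then Some (v ! i) else None) = (if i < length w then Some (w ! i) else None)" for i
    using eq nth by metis
  have "length v = length w"
    using *[of "length v"] *[of "length w"] by (auto split: if_splits)
  moreover have "v ! i = w ! i" if "i < length v" for i
    using *[of i] that \<open>length v = length w\<close> by simp
  ultimately show "v = w" by (rule nth_equalityI)
qed

lemma tape_of_append [simp]:
  "tape_of (xs @ ys) (int (length xs)) = (case ys of [] \<Rightarrow> None | y # _ \<Rightarrow> Some y)"
  by (auto simp: tape_of_def nth_append split: list.split)

lemma tape_of_length [simp]: "tape_of xs (int (length xs)) = None"
  by (simp add: tape_of_def)

lemma tape_of_snoc: "(tape_of xs)(int (length xs) := Some x) = tape_of (xs @ [x])"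
  by (rule ext) (auto simp: tape_of_def nth_append)

lemma encode_coding_simps [simp]:
  "encode_coding [] = []"
  "encode_coding ((w, a) # cs) = map Generator w @ Letter a # encode_coding cs"
  by (simp_all add: encode_coding_def)

text \<open>
  In states \<open>0\<close> to \<open>3\<close> the machine reads forward the words in front of the letters \<open>1\<close> to \<open>4\<close>, where the first
  word must be empty, the next two are copied to the oracle tape and the fourth is skipped. State
  \<open>4\<close> walks back over the fourth word, appending the inverses of its generators in reverse order, until it
  meets the letter in front. States \<open>5\<close>, \<open>6\<close> and \<open>7\<close> are the query, acceptance and rejection. Entries after
  the fourth one are ignored: a longer pattern containing a forbidden one is forbidden anyway.
\<close>

fun matcher_delta :: "('a, 'm) monoid_scheme \<Rightarrow> nat \<Rightarrow> 'a symbol option \<Rightarrow> 'a symbol option \<Rightarrow>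
    nat \<times> ('a symbol option \<times> move) \<times> ('a symbol option \<times> move)" where
  "matcher_delta G q (Some (Generator s)) b =
     (let a = Some (Generator s) in
      if q = 1 \<or> q = 2 then (q, (a, MoveRight), (a, MoveRight))
      else if q = 3 then (3, (a, MoveRight), (b, Stay))
      else if q = 4 then (4, (a, MoveLeft), (Some (Generator (inv\<^bsub>G\<^esub> s)), MoveRight))
      else (7, (a, Stay), (b, Stay)))"
| "matcher_delta G q (Some (Letter k)) b =
     (let a = Some (Letter k) in
      if q < 3 \<and> k = Suc q then (Suc q, (a, MoveRight), (b, Stay))
      else if q = 3 \<and> k = 4 then (4, (a, MoveLeft), (b, Stay))
      else if q = 4 then (5, (a, Stay), (b, Stay))
      else (7, (a, Stay), (b, Stay)))"
| "matcher_delta G q a b = (7, (a, Stay), (b, Stay))"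

definition matcher :: "('a, 'm) monoid_scheme \<Rightarrow> 'a set \<Rightarrow> 'a symbol oracle_machine" where
  "matcher G S = \<lparr>states = {..7}, symbols = Generator ` S \<union> Letter ` {..4},
     start = 0, query = 5, yes = 6, no = 7, accept = 6, delta = matcher_delta G\<rparr>"

lemma matcher_simps [simp]:
  "start (matcher G S) = 0" "query (matcher G S) = 5" "yes (matcher G S) = 6"
  "no (matcher G S) = 7" "accept (matcher G S) = 6" "delta (matcher G S) = matcher_delta G"
  by (simp_all add: matcher_def)

lemma oracle_machine_matcher:
  assumes "finite S" "\<And>s. s \<in> S \<Longrightarrow> inv\<^bsub>G\<^esub> s \<in> S"
  shows "oracle_machine (matcher G S)"
proof -
  define \<Gamma> where "\<Gamma> = insert None (Some ` (Generator ` S \<union> Letter ` {..4}))"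
  have "matcher_delta G q a b \<in> {..7} \<times> (\<Gamma> \<times> UNIV) \<times> (\<Gamma> \<times> UNIV)"
    if "q \<le> 7" "a \<in> \<Gamma>" "b \<in> \<Gamma>" for q a b
  proof -
    have "Some (Generator (inv\<^bsub>G\<^esub> s)) \<in> \<Gamma>" if "a = Some (Generator s)" for s
      using that \<open>a \<in> \<Gamma>\<close> assms(2) by (auto simp: \<Gamma>_def)
    then show ?thesis
      using that by (cases "(G, q, a, b)" rule: matcher_delta.cases) (auto simp: Let_def)
  qed
  then show ?thesis
    using assms(1) by (simp add: oracle_machine_def matcher_def Let_def \<Gamma>_def)
qed

text \<open>
  The head positions during a pass to the right: the work head stands between the part \<open>pre\<close> already read
  and the part \<open>suf\<close> still to be read, the oracle head at the end of the output \<open>out\<close>.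
\<close>

definition scanning :: "nat \<Rightarrow> 's list \<Rightarrow> 's list \<Rightarrow> 's list \<Rightarrow> 's mconfig" where
  "scanning q pre suf out =
     (q, (tape_of (pre @ suf), int (length pre)), (tape_of out, int (length out)))"

context
  fixes G :: "('a, 'm) monoid_scheme" and S :: "'a set" and W :: "'a symbol list set"
begin

abbreviation "accepting \<equiv> reaches_accept W (matcher G S)"

lemma not_accepting_7: "\<not> accepting (7, (t, i), (u, j))"
proof (rule not_reaches_accept_fixed)
  have "matcher_delta G 7 a b = (7, (a, Stay), (b, Stay))" for a :: "'a symbol option" and b
    by (cases "(G, 7::nat, a, b)" rule: matcher_delta.cases) auto
  then show "oracle_step W (matcher G S) (7, (t, i), (u, j)) = (7, (t, i), (u, j))"
    by simp
qed simp

lemma accepting_5: "accepting (5, (t, i), (u, j)) \<longleftrightarrow> u \<in> tape_of ` W"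
proof -
  have "accepting (6, (t, i), (u, j))"
    unfolding reaches_accept_def by (rule exI[of _ 0]) simp
  then show ?thesis
    by (subst reaches_accept_step) (auto simp: not_accepting_7)
qed

lemma accepting_scanning_Nil: "q < 5 \<Longrightarrow> \<not> accepting (scanning q pre [] out)"
  unfolding scanning_def by (subst reaches_accept_step) (auto simp: not_accepting_7)

lemma accepting_copy:
  assumes "q = 1 \<or> q = 2"
  shows "accepting (scanning q pre (map Generator w @ suf) out) \<longleftrightarrow>
    accepting (scanning q (pre @ map Generator w) suf (out @ map Generator w))"
proof (induction w arbitrary: pre out)
  case (Cons s w)
  have "accepting (scanning q pre (map Generator (s # w) @ suf) out) \<longleftrightarrow>
    accepting (scanning q (pre @ [Generator s]) (map Generator w @ suf) (out @ [Generator s]))"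
    using assms unfolding scanning_def
    by (subst reaches_accept_step) (auto simp: Let_def tape_of_snoc fun_upd_idem add.commute)
  then show ?case using Cons by simp
qed simp

lemma accepting_skip:
  "accepting (scanning 3 pre (map Generator w @ suf) out) \<longleftrightarrow>
    accepting (scanning 3 (pre @ map Generator w) suf out)"
proof (induction w arbitrary: pre)
  case (Cons s w)
  have "accepting (scanning 3 pre (map Generator (s # w) @ suf) out) \<longleftrightarrow>
    accepting (scanning 3 (pre @ [Generator s]) (map Generator w @ suf) out)"
    unfolding scanning_def
    by (subst reaches_accept_step) (auto simp: Let_def fun_upd_idem add.commute)
  then show ?case using Cons by simp
qed simp

lemma accepting_letter:
  assumes "q < 3"
  shows "accepting (scanning q pre (Letter k # suf) out) \<longleftrightarrow>
    k = Suc q \<and> accepting (scanning (Suc q) (pre @ [Letter k]) suf out)"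
  using assms unfolding scanning_def
  by (subst reaches_accept_step) (auto simp: Let_def not_accepting_7 fun_upd_idem add.commute)

text \<open>
  The backward pass starts on the last symbol of \<open>w\<close>, or on the letter \<open>k\<close> if \<open>w\<close> is empty: its cell is
  \<open>length pre + length w\<close> since the letter \<open>k\<close> in front of \<open>w\<close> is at \<open>length pre\<close>. That letter ends the pass
  and triggers the query.
\<close>

lemma accepting_back:
  "accepting (4, (tape_of ((pre @ [Letter k]) @ map Generator w @ suf), int (length pre + length w)),
      (tape_of out, int (length out))) \<longleftrightarrow>
    out @ map Generator (rev (map (\<lambda>s. inv\<^bsub>G\<^esub> s) w)) \<in> W"
proof (induction w arbitrary: suf out rule: rev_induct)
  case Nil
  have "tape_of ((pre @ [Letter k]) @ map Generator [] @ suf) (int (length pre)) = Some (Letter k)"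
    by simp
  then show ?case
    by (subst reaches_accept_step) (simp_all add: accepting_5 inj_image_mem_iff[OF inj_tape_of] fun_upd_idem)
next
  case (snoc s w)
  let ?pre = "(pre @ [Letter k]) @ map Generator w"
  let ?t = "tape_of (?pre @ Generator s # suf)"
  have "?t (int (length ?pre)) = Some (Generator s)"
    by (subst tape_of_append) simp
  then have "?t (1 + (int (length pre) + int (length w))) = Some (Generator s)"
    by (simp add: algebra_simps)
  then show ?case
    using snoc[of "Generator s # suf" "out @ [Generator (inv\<^bsub>G\<^esub> s)]"]
    by (subst reaches_accept_step) (simp_all add: Let_def tape_of_snoc fun_upd_idem add.commute)
qed

text \<open>
  The next three lemmas read one entry of the listing each. Stated as equivalences, they rewrite
  acceptance of any input into the shape of the listing, covering rejection as well.
\<close>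

lemma accepting_first:
  "accepting (scanning 0 pre (encode_coding cs) out) \<longleftrightarrow>
    (\<exists>cs'. cs = ([], 1) # cs' \<and> accepting (scanning 1 (pre @ [Letter 1]) (encode_coding cs') out))"
proof (cases "encode_coding cs")
  case Nil
  then show ?thesis using accepting_scanning_Nil[of 0 pre out] by auto
next
  case (Cons a suf)
  then obtain w k cs' where cs: "cs = (w, k) # cs'" by (cases cs) auto
  show ?thesis
  proof (cases w)
    case Nil
    then show ?thesis using cs by (auto simp: accepting_letter)
  next
    case (Cons s w')
    then show ?thesis using cs unfolding scanning_def
      by (subst reaches_accept_step) (auto simp: not_accepting_7)
  qed
qed

lemma accepting_entry:
  assumes "q = 1 \<or> q = 2"
  shows "accepting (scanning q pre (encode_coding cs) out) \<longleftrightarrow>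
    (\<exists>w cs'. cs = (w, Suc q) # cs' \<and>
       accepting (scanning (Suc q) (pre @ map Generator w @ [Letter (Suc q)]) (encode_coding cs')
         (out @ map Generator w)))"
proof (cases cs)
  case Nil
  then show ?thesis using accepting_scanning_Nil[of q pre out] assms by auto
next
  case (Cons c cs')
  then show ?thesis using assms
    by (cases c) (auto simp: accepting_copy accepting_letter)
qed

lemma accepting_last:
  assumes "pre3 \<noteq> []" "last pre3 = Letter 3"
  shows "accepting (scanning 3 pre3 (encode_coding cs) out) \<longleftrightarrow>
    (\<exists>w cs'. cs = (w, 4) # cs' \<and> out @ map Generator (rev (map (\<lambda>s. inv\<^bsub>G\<^esub> s) w)) \<in> W)"
proof -
  define pre where "pre = butlast pre3"
  have pre3: "pre3 = pre @ [Letter 3]"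
    using assms append_butlast_last_id[of pre3] by (simp add: pre_def)
  show ?thesis
  proof (cases cs)
    case Nil
    then show ?thesis using accepting_scanning_Nil[of 3 pre3 out] by auto
  next
    case (Cons c cs')
    obtain w k where c: "c = (w, k)" by fastforce
    let ?suf = "Letter k # encode_coding cs'"
    let ?t = "tape_of ((pre @ [Letter 3]) @ map Generator w @ ?suf)"
    have "accepting (scanning 3 pre3 (encode_coding cs) out) \<longleftrightarrow>
      accepting (scanning 3 ((pre @ [Letter 3]) @ map Generator w) ?suf out)"
      using Cons c pre3 accepting_skip[of "pre @ [Letter 3]" w ?suf out] by simp
    also have "\<dots> \<longleftrightarrow> k = 4 \<and>
      accepting (4, (?t, int (length pre + length w)), (tape_of out, int (length out)))"
    proof -
      have "?t (int (length ((pre @ [Letter 3]) @ map Generator w))) = Some (Letter k)"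
        by (subst append_assoc[symmetric], subst tape_of_append) simp
      then show ?thesis
        unfolding scanning_def
        by (subst reaches_accept_step) (auto simp: Let_def not_accepting_7 fun_upd_idem)
    qed
    also have "\<dots> \<longleftrightarrow> k = 4 \<and> out @ map Generator (rev (map (\<lambda>s. inv\<^bsub>G\<^esub> s) w)) \<in> W"
      using accepting_back by simp
    finally show ?thesis using Cons c by auto
  qed
qed

lemma accepts_matcher:
  "accepts W (matcher G S) (encode_coding cs) \<longleftrightarrow>
    (\<exists>u v w cs'. cs = ([], 1) # (u, 2) # (v, 3) # (w, 4) # cs' \<and>
       map Generator (u @ v @ rev (map (\<lambda>s. inv\<^bsub>G\<^esub> s) w)) \<in> W)"
proof -
  have "accepts W (matcher G S) (encode_coding cs) \<longleftrightarrow>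
    accepting (scanning 0 [] (encode_coding cs) [])"
    by (simp add: accepts_def reaches_accept_def scanning_def)
  also have "\<dots> \<longleftrightarrow> (\<exists>u v w cs'. cs = ([], 1) # (u, 2) # (v, 3) # (w, 4) # cs' \<and>
       map Generator (u @ v @ rev (map (\<lambda>s. inv\<^bsub>G\<^esub> s) w)) \<in> W)"
    by (auto simp: accepting_last accepting_first accepting_entry
        numeral_2_eq_2[symmetric] numeral_3_eq_3[symmetric])
  finally show ?thesis .
qed

end

section \<open>Effective closedness and the theorem\<close>

context symmetric_generators
begin

text \<open>
  Closed because each coding is finite: avoiding it at one place means that one of finitely many
  coordinates misses its letter, a closed condition on that coordinate.
\<close>

lemma subshift_avoiding_codings:
  assumes "finite A" and \<C>: "\<And>c. c \<in> \<C> \<Longrightarrow> pattern_coding S A c"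
  shows "subshift G A (avoiding_codings G A \<C>)"
proof -
  have word: "word_val G w \<in> carrier G" if "c \<in> \<C>" "(w, a) \<in> c" for c w a
  proof (rule word_val_closed)
    have "(w, a) \<in> lists S \<times> A"
      using \<C>[OF that(1)] that(2) unfolding pattern_coding_def by blast
    then show "w \<in> lists S" by blast
  qed
  have closed_coord: "closedin (full_shift_topology G A) {x \<in> full_shift G A. x h \<noteq> a}"
    if "h \<in> carrier G" for h a
  proof -
    have "continuous_map (full_shift_topology G A) (discrete_topology A) (\<lambda>x. x h)"
      unfolding full_shift_topology_def using that by (rule continuous_map_product_projection)
    then have "closedin (full_shift_topology G A)
        {x \<in> topspace (full_shift_topology G A). x h \<in> A - {a}}"
      by (rule closedin_continuous_map_preimage) simp
    moreover have "{x \<in> topspace (full_shift_topology G A). x h \<in> A - {a}} =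
        {x \<in> full_shift G A. x h \<noteq> a}"
      using that by (auto simp: full_shift_def)
    ultimately show ?thesis by simp
  qed
  have "closedin (full_shift_topology G A)
      {x \<in> full_shift G A. \<not> (\<forall>(w, a)\<in>c. x \<in> cylinder G A a (g \<otimes> word_val G w))}"
    if "g \<in> carrier G" "c \<in> \<C>" for g c
  proof -
    have "{x \<in> full_shift G A. \<not> (\<forall>(w, a)\<in>c. x \<in> cylinder G A a (g \<otimes> word_val G w))} =
        \<Union> ((\<lambda>(w, a). {x \<in> full_shift G A. x (g \<otimes> word_val G w) \<noteq> a}) ` c)"
      by (fastforce simp: cylinder_def)
    moreover have "closedin (full_shift_topology G A) \<dots>"
      using \<C>[OF that(2)] word[OF that(2)] that(1) closed_coord
      by (intro closedin_Union) (auto simp: pattern_coding_def)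
    ultimately show ?thesis by simp
  qed
  then have "closedin (full_shift_topology G A) (\<Inter> (insert (full_shift G A)
     ((\<lambda>(g, c). {x \<in> full_shift G A. \<not> (\<forall>(w, a)\<in>c. x \<in> cylinder G A a (g \<otimes> word_val G w))})
       ` (carrier G \<times> \<C>))))"
    using closedin_topspace[of "full_shift_topology G A"] by (intro closedin_Inter) auto
  moreover have "\<Inter> (insert (full_shift G A)
     ((\<lambda>(g, c). {x \<in> full_shift G A. \<not> (\<forall>(w, a)\<in>c. x \<in> cylinder G A a (g \<otimes> word_val G w))})
       ` (carrier G \<times> \<C>))) = avoiding_codings G A \<C>"
    by (auto simp: avoiding_codings_def)
  ultimately have closed: "closedin (full_shift_topology G A) (avoiding_codings G A \<C>)"
    by simp
  have "shift_action G g x \<in> avoiding_codings G A \<C>"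
    if g: "g \<in> carrier G" and x: "x \<in> avoiding_codings G A \<C>" for g x
  proof -
    have full: "x \<in> full_shift G A" "shift_action G g x \<in> full_shift G A"
      using x g shift_action_closed by (auto simp: avoiding_codings_def)
    have "\<not> (\<forall>(w, a)\<in>c. shift_action G g x \<in> cylinder G A a (k \<otimes> word_val G w))"
      if k: "k \<in> carrier G" and c: "c \<in> \<C>" for k c
    proof
      assume *: "\<forall>(w, a)\<in>c. shift_action G g x \<in> cylinder G A a (k \<otimes> word_val G w)"
      have "x \<in> cylinder G A a ((inv g \<otimes> k) \<otimes> word_val G w)" if "(w, a) \<in> c" for w a
        using * that word[OF c that] k g full
        by (auto simp: cylinder_def shift_action_def m_assoc)
      moreover have "inv g \<otimes> k \<in> carrier G" using g k by simp
      ultimately show False using x c unfolding avoiding_codings_def by blast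
    qed
    then show ?thesis using full by (simp add: avoiding_codings_def)
  qed
  then show ?thesis using closed assms by (simp add: subshift_def)
qed

lemma accepts_matcher_word_problem:
  assumes "cs \<in> lists (lists S \<times> A)"
  shows "accepts (map Generator ` word_problem G S) (matcher G S) (encode_coding cs) \<longleftrightarrow>
    (\<exists>u v w cs'. cs = ([], 1) # (u, 2) # (v, 3) # (w, 4) # cs' \<and>
       word_val G w = word_val G u \<otimes> word_val G v)"
proof -
  have key: "map Generator (u @ v @ rev (map (\<lambda>s. inv s) w)) \<in> map Generator ` word_problem G S \<longleftrightarrow>
      word_val G w = word_val G u \<otimes> word_val G v"
    if "u \<in> lists S" "v \<in> lists S" "w \<in> lists S" for u v w
  proof -
    have "inj (map Generator)" by (simp add: inj_def)
    then have "map Generator (u @ v @ rev (map (\<lambda>s. inv s) w)) \<in> map Generator ` word_problem G S \<longleftrightarrow>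
        u @ v @ rev (map (\<lambda>s. inv s) w) \<in> word_problem G S"
      by (rule inj_image_mem_iff)
    also have "\<dots> \<longleftrightarrow> (word_val G u \<otimes> word_val G v) \<otimes> inv (word_val G w) = \<one>"
      using that rev_map_inv_lists[OF that(3)]
      by (simp add: word_problem_def word_val_append word_val_rev_map_inv m_assoc del: in_lists_conv_set)
    also have "\<dots> \<longleftrightarrow> word_val G w = word_val G u \<otimes> word_val G v"
      using that by (metis inv_equality inv_inv m_closed r_inv inv_closed word_val_closed)
    finally show ?thesis .
  qed
  show ?thesis
    unfolding accepts_matcher by (intro ex_cong1 conj_cong refl key) (use assms in auto)
qed

text \<open>
  Every element is represented by a word, so each forbidden occurrence is described by an accepted listing,
  for which the fourth word can be taken to be the concatenation of the second and the third.
\<close>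

lemma effectively_closed_comparison_shift: "effectively_closed G S {..4} comparison_shift"
proof -
  define \<C> where "\<C> = {set cs | cs. cs \<in> lists (lists S \<times> {..4}) \<and>
    accepts (map Generator ` word_problem G S) (matcher G S) (encode_coding cs)}"
  have coding: "pattern_coding S {..4} c" if "c \<in> \<C>" for c
    using that by (auto simp: \<C>_def pattern_coding_def)
  have re: "word_problem_re G S {..4} \<C>"
    unfolding word_problem_re_def \<C>_def
    using oracle_machine_matcher[of S G] finite_S inv_S
    by (intro exI[of _ "matcher G S"]) (auto simp: matcher_def)
  have "comparison_shift = avoiding_codings G {..4} \<C>"
  proof (intro equalityI subsetI)
    fix x assume x: "x \<in> comparison_shift"
    have "\<not> (\<forall>(w, a)\<in>c. x \<in> cylinder G {..4} a (g \<otimes> word_val G w))"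
      if g: "g \<in> carrier G" and c: "c \<in> \<C>" for g c
    proof
      assume occ: "\<forall>(w, a)\<in>c. x \<in> cylinder G {..4} a (g \<otimes> word_val G w)"
      obtain cs where cs: "c = set cs" "cs \<in> lists (lists S \<times> {..4})"
        "accepts (map Generator ` word_problem G S) (matcher G S) (encode_coding cs)"
        using c by (auto simp: \<C>_def)
      then obtain u v w cs' where uvw: "cs = ([], 1) # (u, 2) # (v, 3) # (w, 4) # cs'"
        "word_val G w = word_val G u \<otimes> word_val G v"
        using accepts_matcher_word_problem by blast
      then have "x g = 1 \<and> x (g \<otimes> word_val G u) = 2 \<and> x (g \<otimes> word_val G v) = 3 \<and>
          x (g \<otimes> word_val G u \<otimes> word_val G v) = 4"
        using occ cs g by (auto simp: cylinder_def m_assoc)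
      moreover have "word_val G u \<in> carrier G" "word_val G v \<in> carrier G"
        using cs uvw by auto
      ultimately show False using x g unfolding comparison_shift_def by blast
    qed
    then show "x \<in> avoiding_codings G {..4} \<C>"
      using x by (auto simp: avoiding_codings_def comparison_shift_def)
  next
    fix x assume x: "x \<in> avoiding_codings G {..4} \<C>"
    then have full: "x \<in> full_shift G {..4}" by (simp add: avoiding_codings_def)
    have "\<not> (x g = 1 \<and> x (g \<otimes> a) = 2 \<and> x (g \<otimes> b) = 3 \<and> x (g \<otimes> a \<otimes> b) = 4)"
      if g: "g \<in> carrier G" "a \<in> carrier G" "b \<in> carrier G" for g a b
    proof
      assume occ: "x g = 1 \<and> x (g \<otimes> a) = 2 \<and> x (g \<otimes> b) = 3 \<and> x (g \<otimes> a \<otimes> b) = 4"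
      obtain u v where uv: "u \<in> lists S" "word_val G u = a" "v \<in> lists S" "word_val G v = b"
        using g word_val_surj by metis
      let ?cs = "[([], 1), (u, 2), (v, 3), (u @ v, 4)] :: ('a list \<times> nat) list"
      have cs: "?cs \<in> lists (lists S \<times> {..4})" using uv by auto
      have val: "word_val G (u @ v) = a \<otimes> b" using uv by (simp add: word_val_append del: in_lists_conv_set)
      then have "set ?cs \<in> \<C>"
        using cs accepts_matcher_word_problem[OF cs] uv unfolding \<C>_def by blast
      moreover have "\<forall>(w, l)\<in>set ?cs. x \<in> cylinder G {..4} l (g \<otimes> word_val G w)"
        using occ g uv val full by (auto simp: cylinder_def m_assoc)
      ultimately show False using x g(1) unfolding avoiding_codings_def by blast
    qed
    then show "x \<in> comparison_shift" using full by (simp add: comparison_shift_def)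
  qed
  then show ?thesis
    using coding re subshift_avoiding_codings[OF _ coding]
    by (auto simp: effectively_closed_def)
qed

end

theorem theorem2p17:
  fixes G :: "('a, 'm) monoid_scheme" and S :: "'a set"
  assumes "group G"
    and "finite S" and "S \<subseteq> carrier G" and "generate G S = carrier G"
    and "\<And>s. s \<in> S \<Longrightarrow> inv\<^bsub>G\<^esub> s \<in> S" and "\<one>\<^bsub>G\<^esub> \<in> S"
    and "number_of_ends G S \<ge> 2"
  shows "\<exists>(A :: nat set) X. finite A \<and> effectively_closed G S A X \<and> \<not> sofic G A X"
proof -
  interpret symmetric_generators G S
    using assms(1-5) by (simp add: symmetric_generators_def symmetric_generators_axioms_def)
  obtain C where "C \<subseteq> carrier G" "infinite C" "infinite (carrier G - C)"
    "almost_invariant C"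
    using ends_imp_almost_invariant[OF assms(7)] .
  then have "\<not> sofic G {..4} comparison_shift" by (rule comparison_shift_not_sofic)
  then show ?thesis using effectively_closed_comparison_shift by blast
qed

end
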